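(* For every $\beta>0$, as $n\to\infty$ the entropy of $\mu^e_{U_n;\beta}$ satisfies $$\liminf_{n\to\infty}H(\mu^e_{U_n;\beta})\ \ge\ \max\Big\{\frac{2\beta\log_2 e}{1+e^{10\beta}}+H_0,\ \ 1+\frac{2\beta\log_2 e}{1+e^{10\beta}}-2\beta\log_2 e\Big\}.$$
   Context: $\mathbb{Z}^2$ is the square grid graph, $i\sim j$ iff $\|i-j\|_1=1$. A configuration $\omega\in\Omega=\{0,1\}^{\mathbb{Z}^2}$ satisfies the recovery rule at $i$ if ($\omega_i=1$ if and only if $\omega_j=0$ for all four $j\sim i$). $\mathcal{E}(\omega)$ is the set of sites where the rule is violated. $\omega^e$ is the configuration with $\omega^e_i=1$ iff $i_1+i_2$ is even. $U_n=\{-n,\dots,n\}^2$; $\partial U_n$ is the set of sites outside $U_n$ with a neighbor in $U_n$; $U_n^+=U_n\cup\partial U_n$. $\Omega^e_{U_n}=\{\omega\in\Omega:\omega_{U_n^c}=\omega^e_{U_n^c}\}$, and $\mu^e_{U_n;\beta}$ is the probability measure on $\Omega^e_{U_n}$ with $$\mu^e_{U_n;\beta}(\omega)=\frac{e^{-2\beta|\mathcal{E}(\omega)\cap U_n^+|}}{\sum_{\omega'\in\Omega^e_{U_n}}e^{-2\beta|\mathcal{E}(\omega')\cap U_n^+|}}.$$ Its entropy (rate) is $H(\mu^e_{U_n;\beta})=-\frac{1}{|U_n|}\sum_{\omega\in\Omega^e_{U_n}}\mu^e_{U_n;\beta}(\omega)\log_2\mu^e_{U_n;\beta}(\omega)$.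 $H_0=\lim_{m,n\to\infty}\frac{\log_2|\mathcal{G}_{\mathbb{Z}_{m\times n}}|}{mn}$, where $\mathbb{Z}_{m\times n}=\{-\lfloor m/2\rfloor,\dots,\lfloor m/2\rfloor\}\times\{-\lfloor n/2\rfloor,\dots,\lfloor n/2\rfloor\}$ and $\mathcal{G}_\Lambda$ is the set of restrictions to $\Lambda$ of configurations satisfying the recovery rule at every site of $\mathbb{Z}^2$ (the ground states of the system). *)

theory Defs
  imports Complex_Main "HOL-Library.FuncSet" "HOL-Library.Extended_Real"
begin

type_synonym site = "int \<times> int"

text \<open>Spin 1 is \<open>True\<close>, spin 0 is \<open>False\<close>.\<close>

type_synonym config = "site \<Rightarrow> bool"

definition adjacent :: "site \<Rightarrow> site \<Rightarrow> bool" where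
  "adjacent i j \<longleftrightarrow> \<bar>fst i - fst j\<bar> + \<bar>snd i - snd j\<bar> = 1"

definition recovery_rule :: "config \<Rightarrow> site \<Rightarrow> bool" where
  "recovery_rule \<omega> i \<longleftrightarrow> (\<omega> i \<longleftrightarrow> (\<forall>j. adjacent i j \<longrightarrow> \<not> \<omega> j))"

definition violations :: "config \<Rightarrow> site set" where
  "violations \<omega> = {i. \<not> recovery_rule \<omega> i}"

definition even_config :: config where
  "even_config i \<longleftrightarrow> even (fst i + snd i)"

definition U :: "nat \<Rightarrow> site set" where
  "U n = {- int n..int n} \<times> {- int n..int n}"

definition outer_boundary :: "site set \<Rightarrow> site set" where
  "outer_boundary \<Lambda> = {i. i \<notin> \<Lambda> \<and> (\<exists>j\<in>\<Lambda>. adjacent i j)}"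

definition U_plus :: "nat \<Rightarrow> site set" where
  "U_plus n = U n \<union> outer_boundary (U n)"

definition Omega_even :: "nat \<Rightarrow> config set" where
  "Omega_even n = {\<omega>. \<forall>i. i \<notin> U n \<longrightarrow> \<omega> i = even_config i}"

definition gibbs_weight :: "nat \<Rightarrow> real \<Rightarrow> config \<Rightarrow> real" where
  "gibbs_weight n \<beta> \<omega> = exp (- 2 * \<beta> * real (card (violations \<omega> \<inter> U_plus n)))"

text \<open>The measure is given by its mass function, which is only meaningful on the finite
  set \<open>Omega_even n\<close>.\<close>

definition gibbs_even :: "nat \<Rightarrow> real \<Rightarrow> config \<Rightarrow> real" where
  "gibbs_even n \<beta> \<omega> = gibbs_weight n \<beta> \<omega> / (\<Sum>\<omega>'\<in>Omega_even n. gibbs_weight n \<beta> \<omega>')"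

definition gibbs_entropy :: "nat \<Rightarrow> real \<Rightarrow> real" where
  "gibbs_entropy n \<beta> =
     - (1 / real (card (U n))) *
       (\<Sum>\<omega>\<in>Omega_even n. gibbs_even n \<beta> \<omega> * log 2 (gibbs_even n \<beta> \<omega>))"

definition ground_states :: "config set" where
  "ground_states = {\<omega>. \<forall>i. recovery_rule \<omega> i}"

definition ground_patterns :: "site set \<Rightarrow> config set" where
  "ground_patterns \<Lambda> = (\<lambda>\<omega>. restrict \<omega> \<Lambda>) ` ground_states"

definition rectangle :: "nat \<Rightarrow> nat \<Rightarrow> site set" where
  "rectangle m n =
     {- int (m div 2)..int (m div 2)} \<times> {- int (n div 2)..int (n div 2)}"

text \<open>The limit is the joint one, with \<open>m\<close> and \<open>n\<close> tending to infinity independently.\<close>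

definition H0 :: real where
  "H0 = Lim (at_top \<times>\<^sub>F at_top)
     (\<lambda>(m, n). log 2 (real (card (ground_patterns (rectangle m n)))) / (real m * real n))"

lemma finite_U: "finite (U n)"
  by (simp add: U_def)

lemma finite_Omega_even: "finite (Omega_even n)"
proof (rule finite_subset)
  show "Omega_even n \<subseteq> (\<lambda>A i. if i \<in> U n then i \<in> A else even_config i) ` Pow (U n)"
  proof
    fix \<omega> assume "\<omega> \<in> Omega_even n"
    then have "\<omega> = (\<lambda>i. if i \<in> U n then i \<in> {i \<in> U n. \<omega> i} else even_config i)"
      by (auto simp: Omega_even_def)
    then show "\<omega> \<in> (\<lambda>A i. if i \<in> U n then i \<in> A else even_config i) ` Pow (U n)"
      by (rule image_eqI) auto
  qed
qed (simp add: finite_U)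

lemma gibbs_even_nonneg: "0 \<le> gibbs_even n \<beta> \<omega>"
  by (simp add: gibbs_even_def gibbs_weight_def sum_nonneg)

lemma sum_gibbs_even: "(\<Sum>\<omega>\<in>Omega_even n. gibbs_even n \<beta> \<omega>) = 1"
proof -
  have "even_config \<in> Omega_even n"
    by (simp add: Omega_even_def)
  then have "0 < (\<Sum>\<omega>\<in>Omega_even n. gibbs_weight n \<beta> \<omega>)"
    by (intro sum_pos finite_Omega_even) (auto simp: gibbs_weight_def)
  then show ?thesis
    by (simp add: gibbs_even_def flip: sum_divide_distrib)
qed

end

theory Submission
  imports Defs "HOL-Real_Asymp.Real_Asymp"
begin

text \<open>
  Write \<open>Z\<close> for the partition function and \<open>E \<omega>\<close> for the number of violations of \<open>\<omega>\<close> in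
  \<open>U_plus n\<close>. As the mass of \<open>\<omega>\<close> is \<open>exp (- 2 * \<beta> * E \<omega>) / Z\<close>, its logarithm is affine in
  \<open>E \<omega>\<close>, so the entropy per site is the sum of an energy term, \<open>2 * \<beta> * log 2 (exp 1)\<close> times
  the mean of \<open>E\<close> per site, and of the free term \<open>log 2 Z\<close> per site
  (\<open>gibbs_entropy_decomposition\<close>). The two terms are bounded separately.

  For the energy term, flipping the spin at a site \<open>i\<close> of the box always toggles whether the rule
  is violated at \<open>i\<close>, and it can affect the rule only at \<open>i\<close> and its four neighbours. It is thus an
  involution that exchanges the configurations violated at \<open>i\<close> with the others and changes the
  weight by a factor of at most \<open>exp (10 * \<beta>)\<close>. Hence each site is violated with probability at
  least \<open>1 / (1 + exp (10 * \<beta>))\<close> (\<open>violation_probability_ge\<close>), and this holds exactly for every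
  box.

  For the free term, \<open>Z\<close> is at least the number of configurations in any family times the least
  weight in the family (\<open>log_partition_ge\<close>). The family of all configurations gives
  \<open>1 - 2 * \<beta> * log 2 (exp 1)\<close> in the limit. The family of all ground patterns on the box, extended by
  the even configuration, gives \<open>H0\<close>: such a configuration can be violated only near the boundary
  of the box, which is negligible compared to its area, and there are at least
  \<open>2 powr (H0 * card (U n))\<close> of them. The last fact, like the existence of the limit defining \<open>H0\<close>,
  comes from submultiplicativity of the number of ground patterns: as in Fekete's lemma, \<open>H0\<close> is not
  only a limit but the infimum of the pattern entropy per site over all rectangles
  (\<open>H0_le_box_entropy\<close>).
\<close>

section \<open>Energy and entropy of the Gibbs measure\<close>

definition energy :: "nat \<Rightarrow> config \<Rightarrow> nat" where
  "energy n \<omega> = card (violations \<omega> \<inter> U_plus n)"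

definition partition_function :: "nat \<Rightarrow> real \<Rightarrow> real" where
  "partition_function n \<beta> = (\<Sum>\<omega>\<in>Omega_even n. gibbs_weight n \<beta> \<omega>)"

lemma gibbs_weight_eq: "gibbs_weight n \<beta> \<omega> = exp (- 2 * \<beta> * real (energy n \<omega>))"
  by (simp add: gibbs_weight_def energy_def)

lemma gibbs_even_eq: "gibbs_even n \<beta> \<omega> = gibbs_weight n \<beta> \<omega> / partition_function n \<beta>"
  by (simp add: gibbs_even_def partition_function_def)

lemma partition_function_pos: "0 < partition_function n \<beta>"
proof -
  have "even_config \<in> Omega_even n"
    by (simp add: Omega_even_def)
  then show ?thesis
    unfolding partition_function_def
    by (intro sum_pos finite_Omega_even) (auto simp: gibbs_weight_def)
qed

lemma log2_exp: "log 2 (exp x) = x * log 2 (exp 1)"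
  by (simp add: log_def)

lemma card_U: "card (U n) = (2 * n + 1)\<^sup>2"
proof -
  have "nat (1 + int n + int n) = 2 * n + 1"
    by simp
  then show ?thesis
    by (simp add: U_def card_cartesian_product power2_eq_square add.commute)
qed

lemma U_plus_subset: "U_plus n \<subseteq> U (n + 1)"
  unfolding U_plus_def outer_boundary_def U_def adjacent_def by auto

lemma finite_U_plus: "finite (U_plus n)"
  using U_plus_subset finite_U by (rule finite_subset)

lemma gibbs_entropy_decomposition:
  "gibbs_entropy n \<beta> = (log 2 (partition_function n \<beta>)
     + 2 * \<beta> * log 2 (exp 1) * (\<Sum>\<omega>\<in>Omega_even n. gibbs_even n \<beta> \<omega> * energy n \<omega>))
     / card (U n)"
proof -
  let ?Z = "partition_function n \<beta>" and ?c = "log 2 (exp 1)"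
  have log_mass: "log 2 (gibbs_even n \<beta> \<omega>) = - (2 * \<beta> * ?c * energy n \<omega>) - log 2 ?Z" for \<omega>
    using partition_function_pos[of n \<beta>]
    by (simp add: gibbs_even_eq gibbs_weight_eq log_divide_pos log2_exp[of "- (_)"] algebra_simps)
  have "(\<Sum>\<omega>\<in>Omega_even n. gibbs_even n \<beta> \<omega> * log 2 (gibbs_even n \<beta> \<omega>))
      = (\<Sum>\<omega>\<in>Omega_even n. - (2 * \<beta> * ?c) * (gibbs_even n \<beta> \<omega> * energy n \<omega>)
           - log 2 ?Z * gibbs_even n \<beta> \<omega>)"
    by (intro sum.cong refl) (simp add: log_mass algebra_simps)
  also have "\<dots> = - (2 * \<beta> * ?c) * (\<Sum>\<omega>\<in>Omega_even n. gibbs_even n \<beta> \<omega> * energy n \<omega>)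
       - log 2 ?Z"
    by (simp only: sum_subtractf sum_gibbs_even mult_1_right flip: sum_distrib_left)
  finally show ?thesis
    by (simp add: gibbs_entropy_def add_divide_distrib diff_divide_distrib)
qed

section \<open>Flipping a spin and the mean energy\<close>

definition flip :: "site \<Rightarrow> config \<Rightarrow> config" where
  "flip i \<omega> = fun_upd \<omega> i (\<not> \<omega> i)"

lemma flip_flip [simp]: "flip i (flip i \<omega>) = \<omega>"
  by (simp add: flip_def)

lemma flip_in_Omega_even: "i \<in> U n \<Longrightarrow> \<omega> \<in> Omega_even n \<Longrightarrow> flip i \<omega> \<in> Omega_even n"
  by (auto simp: flip_def Omega_even_def)

text \<open>The rule at \<open>i\<close> compares the spin at \<open>i\<close> with a condition on the neighbours of \<open>i\<close> alone, and
  \<open>i\<close> is not its own neighbour.\<close>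

lemma flip_toggles_violation: "i \<in> violations (flip i \<omega>) \<longleftrightarrow> i \<notin> violations \<omega>"
proof -
  have "flip i \<omega> j = \<omega> j" if "adjacent i j" for j
    using that by (auto simp: flip_def adjacent_def)
  then have "(\<forall>j. adjacent i j \<longrightarrow> \<not> flip i \<omega> j) \<longleftrightarrow> (\<forall>j. adjacent i j \<longrightarrow> \<not> \<omega> j)"
    by blast
  moreover have "flip i \<omega> i \<longleftrightarrow> \<not> \<omega> i"
    by (simp add: flip_def)
  ultimately show ?thesis
    unfolding violations_def recovery_rule_def mem_Collect_eq by blast
qed

lemma energy_flip_le: "energy n (flip i \<omega>) \<le> energy n \<omega> + 5"
proof -
  obtain x y where i: "i = (x, y)"
    by fastforce
  define B where "B = set [(x, y), (x + 1, y), (x - 1, y), (x, y + 1), (x, y - 1)]"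
  have far: "j \<noteq> i \<and> \<not> adjacent j i" if "j \<notin> B" for j
    using that by (cases j) (auto simp: i adjacent_def B_def)
  have "recovery_rule (flip i \<omega>) j \<longleftrightarrow> recovery_rule \<omega> j" if "j \<notin> B" for j
    using far[OF that] unfolding recovery_rule_def flip_def
    by (metis fun_upd_other)
  then have "violations (flip i \<omega>) \<inter> U_plus n \<subseteq> (violations \<omega> \<inter> U_plus n) \<union> B"
    by (auto simp: violations_def)
  then have "energy n (flip i \<omega>) \<le> card ((violations \<omega> \<inter> U_plus n) \<union> B)"
    unfolding energy_def by (intro card_mono) (auto simp: finite_U_plus B_def)
  also have "\<dots> \<le> energy n \<omega> + card B"
    unfolding energy_def by (rule card_Un_le)
  also have "card B \<le> 5"
    unfolding B_def by (rule order.trans[OF card_length]) simp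
  finally show ?thesis
    by simp
qed

lemma gibbs_even_le_flip:
  assumes "\<beta> \<ge> 0"
  shows "gibbs_even n \<beta> \<omega> \<le> exp (10 * \<beta>) * gibbs_even n \<beta> (flip i \<omega>)"
proof -
  have "real (energy n (flip i \<omega>)) \<le> real (energy n \<omega>) + 5"
    using energy_flip_le[of n i \<omega>] by linarith
  then have "\<beta> * energy n (flip i \<omega>) \<le> \<beta> * (real (energy n \<omega>) + 5)"
    using assms by (rule mult_left_mono)
  then have "- 2 * \<beta> * energy n \<omega> \<le> 10 * \<beta> + - 2 * \<beta> * energy n (flip i \<omega>)"
    by (simp add: algebra_simps)
  then have "gibbs_weight n \<beta> \<omega> \<le> exp (10 * \<beta>) * gibbs_weight n \<beta> (flip i \<omega>)"
    unfolding gibbs_weight_eq by (simp only: exp_le_cancel_iff flip: exp_add)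
  then show ?thesis
    using partition_function_pos[of n \<beta>] by (simp add: gibbs_even_eq divide_right_mono)
qed

text \<open>Flipping matches the two events "violated at \<open>i\<close>" and "not violated at \<open>i\<close>" bijectively, so
  the odds of the second one are at most the cost \<open>exp (10 * \<beta>)\<close> of a flip.\<close>

lemma violation_probability_ge:
  assumes "\<beta> \<ge> 0" and i: "i \<in> U n"
  shows "(\<Sum>\<omega> | \<omega> \<in> Omega_even n \<and> i \<in> violations \<omega>. gibbs_even n \<beta> \<omega>)
           \<ge> 1 / (1 + exp (10 * \<beta>))"
    (is "?S \<ge> _")
proof -
  let ?T = "\<Sum>\<omega> | \<omega> \<in> Omega_even n \<and> i \<notin> violations \<omega>. gibbs_even n \<beta> \<omega>"
  have "?T \<le> (\<Sum>\<omega> | \<omega> \<in> Omega_even n \<and> i \<notin> violations \<omega>.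
      exp (10 * \<beta>) * gibbs_even n \<beta> (flip i \<omega>))"
    by (intro sum_mono gibbs_even_le_flip assms)
  also have "\<dots> = exp (10 * \<beta>) *
      (\<Sum>\<omega> | \<omega> \<in> Omega_even n \<and> i \<notin> violations \<omega>. gibbs_even n \<beta> (flip i \<omega>))"
    by (simp add: sum_distrib_left)
  also have "(\<Sum>\<omega> | \<omega> \<in> Omega_even n \<and> i \<notin> violations \<omega>. gibbs_even n \<beta> (flip i \<omega>)) = ?S"
    by (rule sum.reindex_bij_witness[where i = "flip i" and j = "flip i"])
      (auto simp: flip_toggles_violation flip_in_Omega_even[OF i])
  finally have "?T \<le> exp (10 * \<beta>) * ?S" .
  moreover have "?S + ?T = (\<Sum>\<omega>\<in>Omega_even n. gibbs_even n \<beta> \<omega>)"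
    by (subst sum.union_disjoint[symmetric]) (auto simp: finite_Omega_even intro!: sum.cong)
  ultimately have "1 \<le> ?S * (1 + exp (10 * \<beta>))"
    by (simp add: sum_gibbs_even algebra_simps)
  then show ?thesis
    by (simp add: divide_le_eq add_pos_pos)
qed

lemma mean_energy_ge:
  assumes "\<beta> \<ge> 0"
  shows "(\<Sum>\<omega>\<in>Omega_even n. gibbs_even n \<beta> \<omega> * energy n \<omega>)
           \<ge> card (U n) / (1 + exp (10 * \<beta>))"
proof -
  have "card (U n) / (1 + exp (10 * \<beta>)) = (\<Sum>i\<in>U n. 1 / (1 + exp (10 * \<beta>)))"
    by simp
  also have "\<dots> \<le> (\<Sum>i\<in>U n. \<Sum>\<omega> | \<omega> \<in> Omega_even n \<and> i \<in> violations \<omega>. gibbs_even n \<beta> \<omega>)"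
    by (intro sum_mono violation_probability_ge assms)
  also have "\<dots> = (\<Sum>\<omega>\<in>Omega_even n. \<Sum>i | i \<in> U n \<and> i \<in> violations \<omega>. gibbs_even n \<beta> \<omega>)"
    by (rule sum.swap_restrict) (simp_all add: finite_U finite_Omega_even)
  also have "\<dots> \<le> (\<Sum>\<omega>\<in>Omega_even n. gibbs_even n \<beta> \<omega> * energy n \<omega>)"
  proof (rule sum_mono)
    fix \<omega>
    have "card {i \<in> U n. i \<in> violations \<omega>} \<le> energy n \<omega>"
      unfolding energy_def
      by (intro card_mono finite_Int disjI2 finite_U_plus) (auto simp: U_plus_def)
    then show "(\<Sum>i | i \<in> U n \<and> i \<in> violations \<omega>. gibbs_even n \<beta> \<omega>)
        \<le> gibbs_even n \<beta> \<omega> * energy n \<omega>"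
      by (simp add: gibbs_even_nonneg mult.commute mult_left_mono)
  qed
  finally show ?thesis .
qed

section \<open>Lower bounds on the partition function\<close>

definition extend_even :: "nat \<Rightarrow> config \<Rightarrow> config" where
  "extend_even n p i = (if i \<in> U n then p i else even_config i)"

lemma inj_on_extend_even: "inj_on (extend_even n) (U n \<rightarrow>\<^sub>E UNIV)"
proof (rule inj_onI)
  fix p q
  assume pq: "p \<in> U n \<rightarrow>\<^sub>E UNIV" "q \<in> U n \<rightarrow>\<^sub>E UNIV" "extend_even n p = extend_even n q"
  show "p = q"
    using pq(1,2)
  proof (rule PiE_ext)
    fix i assume "i \<in> U n"
    with fun_cong[OF pq(3), of i] show "p i = q i"
      by (simp add: extend_even_def)
  qed
qed

lemma log_partition_ge:
  assumes "\<beta> \<ge> 0" and P: "P \<subseteq> U n \<rightarrow>\<^sub>E UNIV" "P \<noteq> {}"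
    and K: "\<And>p. p \<in> P \<Longrightarrow> energy n (extend_even n p) \<le> K"
  shows "log 2 (partition_function n \<beta>) \<ge> log 2 (card P) - 2 * \<beta> * log 2 (exp 1) * K"
proof -
  have "finite P"
    using P(1) by (rule finite_subset) (simp add: finite_PiE finite_U)
  then have card_pos: "0 < card P"
    using P(2) by (simp add: card_gt_0_iff)
  have "real (card P) * exp (- 2 * \<beta> * K) = (\<Sum>p\<in>P. exp (- 2 * \<beta> * K))"
    by simp
  also have "\<dots> \<le> (\<Sum>p\<in>P. gibbs_weight n \<beta> (extend_even n p))"
  proof (rule sum_mono)
    fix p assume "p \<in> P"
    then have "\<beta> * energy n (extend_even n p) \<le> \<beta> * K"
      using K assms(1) by (intro mult_left_mono) auto
    then show "exp (- 2 * \<beta> * K) \<le> gibbs_weight n \<beta> (extend_even n p)"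
      by (simp add: gibbs_weight_eq)
  qed
  also have "\<dots> = (\<Sum>\<omega>\<in>extend_even n ` P. gibbs_weight n \<beta> \<omega>)"
    using inj_on_subset[OF inj_on_extend_even P(1)] by (simp add: sum.reindex)
  also have "\<dots> \<le> partition_function n \<beta>"
    unfolding partition_function_def
    by (intro sum_mono2 finite_Omega_even)
      (auto simp: Omega_even_def extend_even_def gibbs_weight_def)
  finally have "log 2 (card P * exp (- 2 * \<beta> * K)) \<le> log 2 (partition_function n \<beta>)"
    using card_pos by (intro log_mono) auto
  then show ?thesis
    using card_pos by (simp add: log_mult_pos log2_exp[of "- (_)"] algebra_simps)
qed

lemma log_partition_ge_all_configs:
  assumes "\<beta> \<ge> 0"
  shows "log 2 (partition_function n \<beta>) \<ge> card (U n) - 2 * \<beta> * log 2 (exp 1) * card (U (n + 1))"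
proof -
  let ?P = "U n \<rightarrow>\<^sub>E (UNIV :: bool set)"
  have "energy n \<omega> \<le> card (U (n + 1))" for \<omega>
    unfolding energy_def using U_plus_subset by (intro card_mono finite_U) auto
  then have "log 2 (card ?P) - 2 * \<beta> * log 2 (exp 1) * card (U (n + 1))
      \<le> log 2 (partition_function n \<beta>)"
    by (intro log_partition_ge assms) (auto simp: PiE_eq_empty_iff)
  moreover have "card ?P = 2 ^ card (U n)"
    by (simp add: card_PiE finite_U)
  ultimately show ?thesis
    by (simp add: log_nat_power)
qed

section \<open>Counting ground patterns\<close>

lemma even_config_in_ground_states: "even_config \<in> ground_states"
proof -
  have "recovery_rule even_config (x, y)" for x y
  proof -
    have opposite: "even_config j \<longleftrightarrow> \<not> even_config (x, y)" if "adjacent (x, y) j" for j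
    proof -
      obtain u v where j: "j = (u, v)"
        by fastforce
      have "\<bar>x - u\<bar> + \<bar>y - v\<bar> = 1"
        using that by (simp add: adjacent_def j)
      then have "odd ((x + y) - (u + v))"
        by presburger
      then show ?thesis
        by (auto simp: even_config_def j)
    qed
    moreover have "adjacent (x, y) (x + 1, y)"
      by (simp add: adjacent_def)
    ultimately show ?thesis
      unfolding recovery_rule_def by blast
  qed
  then show ?thesis
    by (simp add: ground_states_def)
qed

lemma ground_patterns_subset_PiE: "ground_patterns \<Lambda> \<subseteq> \<Lambda> \<rightarrow>\<^sub>E UNIV"
  by (auto simp: ground_patterns_def)

lemma finite_ground_patterns: "finite \<Lambda> \<Longrightarrow> finite (ground_patterns \<Lambda>)"
  by (rule finite_subset[OF ground_patterns_subset_PiE]) (simp add: finite_PiE)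

lemma ground_patterns_nonempty: "ground_patterns \<Lambda> \<noteq> {}"
  using even_config_in_ground_states by (auto simp: ground_patterns_def)

lemma card_ground_patterns_pos: "finite \<Lambda> \<Longrightarrow> 0 < card (ground_patterns \<Lambda>)"
  by (simp add: card_gt_0_iff finite_ground_patterns ground_patterns_nonempty)

lemma card_ground_patterns_mono:
  assumes "finite \<Lambda>'" "\<Lambda> \<subseteq> \<Lambda>'"
  shows "card (ground_patterns \<Lambda>) \<le> card (ground_patterns \<Lambda>')"
proof (rule surj_card_le)
  show "ground_patterns \<Lambda> \<subseteq> (\<lambda>p. restrict p \<Lambda>) ` ground_patterns \<Lambda>'"
    using assms(2) by (auto simp: ground_patterns_def image_image Int_absorb1)
qed (simp add: assms finite_ground_patterns)

text \<open>A pattern on a union is determined by its restrictions to the two parts, but two ground patterns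
  need not be compatible, so this is only an inequality even for disjoint parts.\<close>

lemma card_ground_patterns_Un:
  assumes "finite A" "finite B"
  shows "card (ground_patterns (A \<union> B)) \<le> card (ground_patterns A) * card (ground_patterns B)"
proof -
  let ?join = "\<lambda>(p, q). \<lambda>i\<in>A \<union> B. if i \<in> A then p i else q i"
  have "ground_patterns (A \<union> B) \<subseteq> ?join ` (ground_patterns A \<times> ground_patterns B)"
  proof
    fix r assume "r \<in> ground_patterns (A \<union> B)"
    then obtain \<omega> where "\<omega> \<in> ground_states" "r = restrict \<omega> (A \<union> B)"
      by (auto simp: ground_patterns_def)
    then show "r \<in> ?join ` (ground_patterns A \<times> ground_patterns B)"
      by (intro image_eqI[where x = "(restrict \<omega> A, restrict \<omega> B)"])
        (auto simp: ground_patterns_def fun_eq_iff)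
  qed
  then have "card (ground_patterns (A \<union> B)) \<le> card (ground_patterns A \<times> ground_patterns B)"
    by (rule surj_card_le[rotated]) (simp add: assms finite_ground_patterns)
  then show ?thesis
    by (simp add: card_cartesian_product)
qed

definition translate :: "site \<Rightarrow> site \<Rightarrow> site" where
  "translate v i = (fst i + fst v, snd i + snd v)"

lemma inj_translate: "inj (translate v)"
  by (auto simp: inj_def translate_def prod_eq_iff)

lemma finite_translate_iff [simp]: "finite (translate v ` \<Lambda>) \<longleftrightarrow> finite \<Lambda>"
  by (rule finite_image_iff) (rule inj_on_subset[OF inj_translate subset_UNIV])

lemma ground_states_translate:
  assumes "\<omega> \<in> ground_states"
  shows "\<omega> \<circ> translate v \<in> ground_states"
proof -
  have "recovery_rule (\<omega> \<circ> translate v) i" for i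
  proof -
    let ?w = "(- fst v, - snd v)"
    have adj: "adjacent (translate v i) j \<longleftrightarrow> adjacent i (translate ?w j)" for j
      by (simp add: adjacent_def translate_def algebra_simps)
    have inverses: "translate v (translate ?w j) = j" "translate ?w (translate v j) = j" for j
      by (simp_all add: translate_def)
    have "(\<forall>j. adjacent i j \<longrightarrow> \<not> \<omega> (translate v j))
        \<longleftrightarrow> (\<forall>j. adjacent (translate v i) j \<longrightarrow> \<not> \<omega> j)"
      using adj inverses by metis
    moreover have "recovery_rule \<omega> (translate v i)"
      using assms unfolding ground_states_def by blast
    ultimately show ?thesis
      by (simp add: recovery_rule_def)
  qed
  then show ?thesis
    by (simp add: ground_states_def)
qed

lemma card_ground_patterns_translate_le:
  assumes "finite \<Lambda>"
  shows "card (ground_patterns (translate v ` \<Lambda>)) \<le> card (ground_patterns \<Lambda>)"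
proof (rule surj_card_le)
  let ?back = "\<lambda>p. \<lambda>i\<in>translate v ` \<Lambda>. p (translate (- fst v, - snd v) i)"
  show "ground_patterns (translate v ` \<Lambda>) \<subseteq> ?back ` ground_patterns \<Lambda>"
  proof
    fix r assume "r \<in> ground_patterns (translate v ` \<Lambda>)"
    then obtain \<omega> where \<omega>: "\<omega> \<in> ground_states" "r = restrict \<omega> (translate v ` \<Lambda>)"
      by (auto simp: ground_patterns_def)
    have "r = ?back (restrict (\<omega> \<circ> translate v) \<Lambda>)"
      by (auto simp: \<omega>(2) fun_eq_iff translate_def)
    moreover have "restrict (\<omega> \<circ> translate v) \<Lambda> \<in> ground_patterns \<Lambda>"
      using ground_states_translate[OF \<omega>(1)] by (auto simp: ground_patterns_def)
    ultimately show "r \<in> ?back ` ground_patterns \<Lambda>"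
      by blast
  qed
qed (simp add: assms finite_ground_patterns)

lemma card_ground_patterns_cover:
  assumes "finite T" "finite B" "\<Lambda> \<subseteq> (\<Union>v\<in>T. translate v ` B)"
  shows "card (ground_patterns \<Lambda>) \<le> card (ground_patterns B) ^ card T"
proof -
  have "card (ground_patterns (\<Union>v\<in>T. translate v ` B)) \<le> card (ground_patterns B) ^ card T"
    using assms(1)
  proof (induction T rule: finite_induct)
    case empty
    have "ground_patterns {} \<subseteq> {\<lambda>_. undefined}"
      by (auto simp: ground_patterns_def)
    then show ?case
      by (auto dest: card_mono[rotated])
  next
    case (insert v T)
    have "card (ground_patterns (\<Union>w\<in>insert v T. translate w ` B))
        \<le> card (ground_patterns (translate v ` B))
          * card (ground_patterns (\<Union>w\<in>T. translate w ` B))"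
      using card_ground_patterns_Un[of "translate v ` B" "\<Union>w\<in>T. translate w ` B"] insert assms(2)
      by simp
    also have "\<dots> \<le> card (ground_patterns B) * card (ground_patterns B) ^ card T"
      by (intro mult_le_mono card_ground_patterns_translate_le insert.IH assms)
    finally show ?case
      using insert by simp
  qed
  moreover have "card (ground_patterns \<Lambda>) \<le> card (ground_patterns (\<Union>v\<in>T. translate v ` B))"
    using assms by (intro card_ground_patterns_mono) auto
  ultimately show ?thesis
    by simp
qed

section \<open>The ground state entropy as an infimum\<close>

definition box :: "nat \<Rightarrow> nat \<Rightarrow> site set" where
  "box a b = {0..<int a} \<times> {0..<int b}"

definition box_entropy :: "nat \<Rightarrow> nat \<Rightarrow> real" where
  "box_entropy a b = log 2 (card (ground_patterns (box a b))) / (real a * real b)"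

lemma finite_box: "finite (box a b)"
  by (simp add: box_def)

lemma log_card_ground_patterns_nonneg:
  "finite \<Lambda> \<Longrightarrow> 0 \<le> log 2 (card (ground_patterns \<Lambda>))"
  using card_ground_patterns_pos[of \<Lambda>] by (simp add: Suc_le_eq)

lemma box_entropy_nonneg: "0 \<le> box_entropy a b"
  by (simp add: box_entropy_def log_card_ground_patterns_nonneg finite_box)

text \<open>Tiling a large box by translates of a fixed one. The quotient is rounded up to
  \<open>c div a + 1\<close>, which costs at most one extra tile per row and column.\<close>

lemma log_card_ground_patterns_box_le:
  assumes "a > 0" "b > 0"
  shows "log 2 (card (ground_patterns (box c d)))
           \<le> box_entropy a b * (real c + real a) * (real d + real b)"
proof -
  define p q where "p = c div a + 1" and "q = d div b + 1"
  define T where "T = (\<lambda>(i, j). (int i * int a, int j * int b)) ` ({..<p} \<times> {..<q})"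
  have "box c d \<subseteq> (\<Union>v\<in>T. translate v ` box a b)"
  proof
    fix z assume "z \<in> box c d"
    then obtain x y where z: "z = (int x, int y)" "x < c" "y < d"
      by (cases z) (auto simp: box_def elim!: nonneg_int_cases)
    have "translate (int (x div a) * int a, int (y div b) * int b) (int (x mod a), int (y mod b)) = z"
      by (simp add: translate_def z flip: of_nat_mult of_nat_add)
    moreover have "(int (x mod a), int (y mod b)) \<in> box a b"
      using assms by (simp add: box_def)
    moreover have "(int (x div a) * int a, int (y div b) * int b) \<in> T"
      unfolding T_def using z
      by (intro image_eqI[where x = "(x div a, y div b)"])
        (auto simp: p_def q_def less_Suc_eq_le div_le_mono)
    ultimately show "z \<in> (\<Union>v\<in>T. translate v ` box a b)"
      by (metis UN_iff image_eqI)
  qed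
  then have "card (ground_patterns (box c d)) \<le> card (ground_patterns (box a b)) ^ card T"
    by (intro card_ground_patterns_cover finite_box) (auto simp: T_def)
  also have "\<dots> \<le> card (ground_patterns (box a b)) ^ (p * q)"
  proof (rule power_increasing)
    show "card T \<le> p * q"
      unfolding T_def by (rule order.trans[OF card_image_le]) (auto simp: card_cartesian_product)
  qed (use card_ground_patterns_pos[OF finite_box, of a b] in simp)
  finally have "log 2 (card (ground_patterns (box c d)))
      \<le> log 2 (real (card (ground_patterns (box a b)) ^ (p * q)))"
    using card_ground_patterns_pos[OF finite_box] by (intro log_mono) (auto simp: of_nat_le_iff)
  also have "\<dots> = p * q * log 2 (card (ground_patterns (box a b)))"
    using card_ground_patterns_pos[OF finite_box, of a b] by (simp add: log_nat_power)
  also have "\<dots> = box_entropy a b * (real (p * a) * real (q * b))"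
    using assms by (simp add: box_entropy_def)
  also have "\<dots> \<le> box_entropy a b * ((real c + real a) * (real d + real b))"
  proof -
    have "p * a \<le> c + a" "q * b \<le> d + b"
      by (simp_all add: p_def q_def)
    then have "real (p * a) \<le> real c + real a" "real (q * b) \<le> real d + real b"
      by linarith+
    then show ?thesis
      by (intro mult_left_mono mult_mono box_entropy_nonneg) auto
  qed
  finally show ?thesis
    by (simp add: mult.assoc)
qed

lemma card_ground_patterns_rectangle:
  "card (ground_patterns (rectangle m n))
     = card (ground_patterns (box (2 * (m div 2) + 1) (2 * (n div 2) + 1)))"
    (is "card (ground_patterns ?R) = card (ground_patterns ?B)")
proof (rule antisym)
  let ?v = "(- int (m div 2), - int (n div 2))" and ?w = "(int (m div 2), int (n div 2))"
  have "?R \<subseteq> translate ?v ` ?B"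
  proof
    fix z assume "z \<in> ?R"
    then show "z \<in> translate ?v ` ?B"
      by (intro image_eqI[where x = "translate ?w z"])
        (auto simp: rectangle_def box_def translate_def)
  qed
  then show "card (ground_patterns ?R) \<le> card (ground_patterns ?B)"
    using card_ground_patterns_cover[of "{?v}" ?B ?R] finite_box by simp
  have "?B \<subseteq> translate ?w ` ?R"
  proof
    fix z assume "z \<in> ?B"
    then show "z \<in> translate ?w ` ?R"
      by (intro image_eqI[where x = "translate ?v z"])
        (auto simp: rectangle_def box_def translate_def)
  qed
  then show "card (ground_patterns ?B) \<le> card (ground_patterns ?R)"
    using card_ground_patterns_cover[of "{?w}" ?R ?B] by (simp add: rectangle_def)
qed

text \<open>The two-parameter form of Fekete's lemma. The rectangle for \<open>(m, n)\<close> has sides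
  \<open>2 * (m div 2) + 1\<close> and \<open>2 * (n div 2) + 1\<close>, which lie between \<open>m\<close> and \<open>m + 1\<close>, respectively
  \<open>n\<close> and \<open>n + 1\<close>. Normalising by \<open>m * n\<close> therefore only increases the entropy per site, and the
  increase vanishes in the limit.\<close>

lemma H0_eq_Inf: "H0 = (INF (a, b)\<in>{0<..} \<times> {0<..}. box_entropy a b)"
proof -
  define L where "L = (INF (a, b)\<in>{0<..} \<times> {0<..}. box_entropy a b)"
  let ?F = "at_top \<times>\<^sub>F at_top :: (nat \<times> nat) filter"
  let ?h = "\<lambda>(m, n). log 2 (real (card (ground_patterns (rectangle m n)))) / (real m * real n)"
  have bdd: "bdd_below ((\<lambda>(a, b). box_entropy a b) ` ({0<..} \<times> {0<..}))"
    by (rule bdd_belowI[of _ 0]) (auto simp: box_entropy_nonneg)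
  have L_le: "L \<le> box_entropy a b" if "a > 0" "b > 0" for a b
    unfolding L_def using that by (intro cINF_lower2[OF bdd, of "(a, b)"]) auto
  have large: "eventually (\<lambda>(m, n). m > 0 \<and> n > 0) ?F"
    unfolding case_prod_unfold by (intro eventually_prodI eventually_gt_at_top)
  have fst_lim: "filterlim fst at_top ?F" and snd_lim: "filterlim snd at_top ?F"
    by (simp_all add: filterlim_def filtermap_fst_prod_filter filtermap_snd_prod_filter)
  have lower: "L \<le> ?h (m, n)" if "m > 0" "n > 0" for m n
  proof -
    let ?M = "2 * (m div 2) + 1" and ?N = "2 * (n div 2) + 1"
    have "L \<le> box_entropy ?M ?N"
      by (rule L_le) auto
    also have "\<dots> \<le> ?h (m, n)"
    proof -
      have "m * n \<le> ?M * ?N"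
        by (intro mult_le_mono) presburger+
      then have "real m * real n \<le> real ?M * real ?N"
        by (metis of_nat_le_iff of_nat_mult)
      then show ?thesis
        using that
        by (simp add: box_entropy_def card_ground_patterns_rectangle del: of_nat_add of_nat_mult)
          (intro divide_left_mono log_card_ground_patterns_nonneg finite_box, auto)
    qed
    finally show ?thesis .
  qed
  have upper: "?h (m, n) \<le> box_entropy a b *
      ((real m + 1 + real a) / real m * ((real n + 1 + real b) / real n))"
    if "m > 0" "n > 0" "a > 0" "b > 0" for m n a b
  proof -
    let ?M = "2 * (m div 2) + 1" and ?N = "2 * (n div 2) + 1"
    have "log 2 (card (ground_patterns (rectangle m n)))
        \<le> box_entropy a b * ((real ?M + real a) * (real ?N + real b))"
      using log_card_ground_patterns_box_le[OF that(3,4), of ?M ?N]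
      by (simp only: card_ground_patterns_rectangle mult.assoc)
    also have "\<dots> \<le> box_entropy a b * ((real m + 1 + real a) * (real n + 1 + real b))"
    proof -
      have "?M \<le> m + 1" "?N \<le> n + 1"
        by presburger+
      then have "real ?M \<le> real m + 1" "real ?N \<le> real n + 1"
        by linarith+
      then show ?thesis
        by (intro mult_left_mono mult_mono box_entropy_nonneg) auto
    qed
    finally show ?thesis
      using that by (simp add: divide_simps)
  qed
  have "(?h \<longlongrightarrow> L) ?F"
  proof (rule order_tendstoI)
    fix u assume "u < L"
    show "eventually (\<lambda>z. u < ?h z) ?F"
      using large
    proof eventually_elim
      case (elim z)
      then show ?case
        using lower[of "fst z" "snd z"] \<open>u < L\<close> by (cases z) auto
    qed
  next
    fix u assume "L < u"
    then obtain a b where ab: "a > 0" "b > 0" "box_entropy a b < u"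
      unfolding L_def by (subst (asm) cINF_less_iff[OF _ bdd]) auto
    have ratio: "((\<lambda>m. (real m + 1 + real k) / real m) \<longlongrightarrow> 1) at_top" for k
      by real_asymp
    have "((\<lambda>z. box_entropy a b * ((real (fst z) + 1 + real a) / real (fst z) *
        ((real (snd z) + 1 + real b) / real (snd z)))) \<longlongrightarrow> box_entropy a b * (1 * 1)) ?F"
      by (intro tendsto_intros filterlim_compose[OF ratio] fst_lim snd_lim)
    then have "eventually (\<lambda>z. box_entropy a b * ((real (fst z) + 1 + real a) / real (fst z) *
        ((real (snd z) + 1 + real b) / real (snd z))) < u) ?F"
      by (rule order_tendstoD) (simp add: ab)
    with large show "eventually (\<lambda>z. ?h z < u) ?F"
    proof eventually_elim
      case (elim z)
      then show ?case
        using upper[of "fst z" "snd z" a b] ab by (cases z) auto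
    qed
  qed
  then show ?thesis
    unfolding H0_def L_def[symmetric]
    by (intro tendsto_Lim) (simp_all add: prod_filter_eq_bot)
qed

lemma H0_le_box_entropy: "a > 0 \<Longrightarrow> b > 0 \<Longrightarrow> H0 \<le> box_entropy a b"
  unfolding H0_eq_Inf
  by (intro cINF_lower2[where x = "(a, b)"] bdd_belowI[of _ 0]) (auto simp: box_entropy_nonneg)

lemma log_card_ground_patterns_U_ge: "H0 * card (U n) \<le> log 2 (card (ground_patterns (U n)))"
proof -
  have "U n = rectangle (2 * n) (2 * n)"
    by (simp add: U_def rectangle_def)
  then have card_eq: "card (ground_patterns (U n)) = card (ground_patterns (box (2 * n + 1) (2 * n + 1)))"
    using card_ground_patterns_rectangle[of "2 * n" "2 * n"] by simp
  have pos: "0 < (real (2 * n + 1))\<^sup>2"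
    by simp
  have "H0 \<le> log 2 (card (ground_patterns (U n))) / (real (2 * n + 1))\<^sup>2"
    using H0_le_box_entropy[of "2 * n + 1" "2 * n + 1"]
    by (simp add: box_entropy_def card_eq power2_eq_square)
  then show ?thesis
    using pos by (simp only: pos_le_divide_eq card_U of_nat_power)
qed

text \<open>A site of \<open>U (n - 1)\<close> and its neighbours all lie in \<open>U n\<close>, where the extension agrees with a
  ground state. Violations can therefore only occur in the annulus between \<open>U (n - 1)\<close> and
  \<open>U (n + 1)\<close>, which has \<open>16 * n + 8\<close> sites.\<close>

lemma energy_extend_ground_pattern_le:
  assumes "n \<ge> 1" "p \<in> ground_patterns (U n)"
  shows "energy n (extend_even n p) \<le> 16 * n + 8"
proof -
  obtain \<omega> where \<omega>: "\<omega> \<in> ground_states" "p = restrict \<omega> (U n)"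
    using assms(2) by (auto simp: ground_patterns_def)
  have "recovery_rule (extend_even n p) i" if i: "i \<in> U (n - 1)" for i
  proof -
    have agree: "extend_even n p j = \<omega> j" if "j = i \<or> adjacent i j" for j
    proof -
      have "j \<in> U n"
        using that i assms(1) by (cases i; cases j) (auto simp: U_def adjacent_def of_nat_diff)
      then show ?thesis
        by (simp add: extend_even_def \<omega>(2))
    qed
    have "recovery_rule \<omega> i"
      using \<omega>(1) unfolding ground_states_def by blast
    then show ?thesis
      using agree by (simp add: recovery_rule_def)
  qed
  then have "violations (extend_even n p) \<inter> U_plus n \<subseteq> U (n + 1) - U (n - 1)"
    using U_plus_subset by (auto simp: violations_def)
  then have "energy n (extend_even n p) \<le> card (U (n + 1) - U (n - 1))"
    unfolding energy_def by (intro card_mono) (auto simp: finite_U)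
  also have "\<dots> = card (U (n + 1)) - card (U (n - 1))"
    by (intro card_Diff_subset finite_U) (auto simp: U_def)
  also have "\<dots> = 16 * n + 8"
  proof -
    obtain k where "n = Suc k"
      using assms(1) by (cases n) auto
    then show ?thesis
      unfolding card_U by (simp add: power2_eq_square algebra_simps)
  qed
  finally show ?thesis .
qed

lemma log_partition_ge_ground_patterns:
  assumes "\<beta> \<ge> 0" "n \<ge> 1"
  shows "log 2 (partition_function n \<beta>)
           \<ge> H0 * card (U n) - 2 * \<beta> * log 2 (exp 1) * (16 * real n + 8)"
proof -
  have "log 2 (card (ground_patterns (U n))) - 2 * \<beta> * log 2 (exp 1) * real (16 * n + 8)
      \<le> log 2 (partition_function n \<beta>)"
    by (intro log_partition_ge assms(1) ground_patterns_subset_PiE ground_patterns_nonempty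
        energy_extend_ground_pattern_le assms(2))
  then show ?thesis
    using log_card_ground_patterns_U_ge[of n] by simp
qed

section \<open>The entropy bound\<close>

lemma gibbs_entropy_ge:
  fixes \<beta> :: real
  assumes "\<beta> \<ge> 0" "n \<ge> 1"
  defines "c \<equiv> 2 * \<beta> * log 2 (exp 1)"
  shows "gibbs_entropy n \<beta> \<ge> c / (1 + exp (10 * \<beta>)) +
    max (H0 - c * ((16 * real n + 8) / (2 * real n + 1)\<^sup>2))
        (1 - c * ((2 * real n + 3)\<^sup>2 / (2 * real n + 1)\<^sup>2))"
proof -
  let ?u = "real (card (U n))" and ?logZ = "log 2 (partition_function n \<beta>)"
  have u: "?u = (2 * real n + 1)\<^sup>2" "real (card (U (n + 1))) = (2 * real n + 3)\<^sup>2"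
    by (simp_all only: card_U) (simp_all add: algebra_simps)
  have u_pos: "?u > 0"
    unfolding u(1) by (simp add: add_nonneg_pos)
  have "c \<ge> 0"
    using assms(1) by (simp add: c_def)
  have "c * (?u / (1 + exp (10 * \<beta>)))
      \<le> c * (\<Sum>\<omega>\<in>Omega_even n. gibbs_even n \<beta> \<omega> * energy n \<omega>)"
    using mean_energy_ge[OF assms(1)] \<open>c \<ge> 0\<close> by (rule mult_left_mono)
  then have "(?logZ + c * (?u / (1 + exp (10 * \<beta>)))) / ?u \<le> gibbs_entropy n \<beta>"
    unfolding gibbs_entropy_decomposition c_def[symmetric]
    by (intro divide_right_mono) auto
  moreover have "(?logZ + c * (?u / (1 + exp (10 * \<beta>)))) / ?u = c / (1 + exp (10 * \<beta>)) + ?logZ / ?u"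
    using u_pos by (simp add: add_divide_distrib)
  moreover have "H0 - c * ((16 * real n + 8) / ?u) \<le> ?logZ / ?u"
    using log_partition_ge_ground_patterns[OF assms(1,2)] u_pos
    by (simp add: pos_le_divide_eq left_diff_distrib c_def)
  moreover have "1 - c * (real (card (U (n + 1))) / ?u) \<le> ?logZ / ?u"
    using log_partition_ge_all_configs[OF assms(1), of n] u_pos
    by (simp add: pos_le_divide_eq left_diff_distrib c_def)
  ultimately show ?thesis
    unfolding u by simp
qed

theorem theorem4p4:
  fixes \<beta> :: real
  assumes "\<beta> > 0"
  shows "liminf (\<lambda>n. ereal (gibbs_entropy n \<beta>)) \<ge>
    ereal (max (2 * \<beta> * log 2 (exp 1) / (1 + exp (10 * \<beta>)) + H0)
               (1 + 2 * \<beta> * log 2 (exp 1) / (1 + exp (10 * \<beta>)) - 2 * \<beta> * log 2 (exp 1)))"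
proof -
  define c where "c = 2 * \<beta> * log 2 (exp 1)"
  define e where "e = c / (1 + exp (10 * \<beta>))"
  let ?g = "\<lambda>n. e +
    max (H0 - c * ((16 * real n + 8) / (2 * real n + 1)\<^sup>2))
        (1 - c * ((2 * real n + 3)\<^sup>2 / (2 * real n + 1)\<^sup>2))"
  have boundary: "(\<lambda>n. (16 * real n + 8) / (2 * real n + 1)\<^sup>2) \<longlonglongrightarrow> 0"
    and area: "(\<lambda>n. (2 * real n + 3)\<^sup>2 / (2 * real n + 1)\<^sup>2) \<longlonglongrightarrow> 1"
    by real_asymp+
  have "?g \<longlonglongrightarrow> e + max (H0 - c * 0) (1 - c * 1)"
    by (intro tendsto_intros tendsto_max boundary area)
  then have "liminf (\<lambda>n. ereal (?g n)) = ereal (e + max (H0 - c * 0) (1 - c * 1))"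
    by (intro lim_imp_Liminf) simp_all
  moreover have "liminf (\<lambda>n. ereal (?g n)) \<le> liminf (\<lambda>n. ereal (gibbs_entropy n \<beta>))"
  proof (rule Liminf_mono)
    show "eventually (\<lambda>n. ereal (?g n) \<le> ereal (gibbs_entropy n \<beta>)) sequentially"
      using eventually_ge_at_top[of 1]
    proof eventually_elim
      case (elim n)
      then show ?case
        using gibbs_entropy_ge[of \<beta> n] assms unfolding e_def c_def ereal_less_eq by simp
    qed
  qed
  moreover have "e + max (H0 - c * 0) (1 - c * 1) = max (e + H0) (1 + e - c)"
    by (simp add: max_def)
  ultimately show ?thesis
    unfolding e_def c_def by simp
qed

end
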